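(* Let $n\ge 3$ and let $C_n$ be the cycle of length $n$. Then for all positive integers $a,b$ with $\frac{a}{b}\ge 2+\lfloor n/2\rfloor^{-1}$, the cycle $C_n$ is $(a,b)$-free-choosable. Moreover, the free-choice ratio of $C_n$ satisfies $$\mathrm{fchr}(C_n)=2+\Big\lfloor \frac{n}{2}\Big\rfloor^{-1}.$$
   Context: For a graph $G$, a list $L$ assigns to each vertex $v$ a finite set $L(v)\subseteq\mathbb{N}$. An $(L,b)$-coloring is a map $c$ with $c(v)\subseteq L(v)$, $|c(v)|=b$ for each vertex, and $c(v)\cap c(v')=\emptyset$ for each edge $vv'$. $G$ is $(a,b)$-free-choosable if for every vertex $v_0\in V(G)$ and every list $L$ with $|L(v)|=a$ for all $v\ne v_0$ and $|L(v_0)|=b$, there exists an $(L,b)$-coloring of $G$. The free-choice ratio is $\mathrm{fchr}(G)=\inf\{a/b : G \text{ is } (a,b)\text{-free-choosable}\}$. $\lfloor x\rfloor$ is the greatest integer $\le x$. *)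

theory Defs
  imports Complex_Main "Graph_Theory.Pair_Digraph"
begin

text \<open>A finite simple graph is a symmetric loopless digraph (locale \<^locale>\<open>pair_graph\<close>):
  an undirected edge \<open>uv\<close> is represented by the two arcs \<open>(u,v)\<close> and \<open>(v,u)\<close>.\<close>

definition list_assignment :: "'a pair_pre_digraph \<Rightarrow> ('a \<Rightarrow> nat set) \<Rightarrow> bool" where
  "list_assignment G L \<longleftrightarrow> (\<forall>v \<in> pverts G. finite (L v))"

definition list_coloring ::
  "'a pair_pre_digraph \<Rightarrow> ('a \<Rightarrow> nat set) \<Rightarrow> nat \<Rightarrow> ('a \<Rightarrow> nat set) \<Rightarrow> bool" where
  "list_coloring G L b c \<longleftrightarrow>
     (\<forall>v \<in> pverts G. c v \<subseteq> L v \<and> card (c v) = b) \<and>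
     (\<forall>(u, v) \<in> parcs G. c u \<inter> c v = {})"

definition free_choosable :: "'a pair_pre_digraph \<Rightarrow> nat \<Rightarrow> nat \<Rightarrow> bool" where
  "free_choosable G a b \<longleftrightarrow>
     (\<forall>v0 \<in> pverts G. \<forall>L. list_assignment G L \<longrightarrow>
        (\<forall>v \<in> pverts G. v \<noteq> v0 \<longrightarrow> card (L v) = a) \<longrightarrow> card (L v0) = b \<longrightarrow>
        (\<exists>c. list_coloring G L b c))"

definition fchr :: "'a pair_pre_digraph \<Rightarrow> real" where
  "fchr G = Inf {real a / real b | a b. 0 < a \<and> 0 < b \<and> free_choosable G a b}"

text \<open>Meaningful for \<open>n \<ge> 3\<close>; for \<open>n = 1\<close> the definition gives a loop.\<close>

definition cycle_graph :: "nat \<Rightarrow> nat pair_pre_digraph" where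
  "cycle_graph n = \<lparr> pverts = {..<n},
     parcs = {(i, j). i < n \<and> j < n \<and> (j = Suc i mod n \<or> i = Suc j mod n)} \<rparr>"

lemma pair_graph_cycle_graph:
  assumes "3 \<le> n"
  shows "pair_graph (cycle_graph n)"
proof
  show "finite (pverts (cycle_graph n))"
    by (simp add: cycle_graph_def)
  show "finite (parcs (cycle_graph n))"
    by (rule finite_subset[of _ "{..<n} \<times> {..<n}"]) (auto simp: cycle_graph_def)
  have "Suc x mod n \<noteq> x" if "x < n" for x
    using that assms by (cases "Suc x = n") auto
  then show "fst e \<noteq> snd e" if "e \<in> parcs (cycle_graph n)" for e
    using that by (cases e) (auto simp: cycle_graph_def, (metis)+)
  show "symmetric (with_proj (cycle_graph n))"
    by (auto simp: symmetric_def arcs_ends_def arc_to_ends_def cycle_graph_def sym_def)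
qed (auto simp: cycle_graph_def)

end

theory Submission
  imports Defs
begin

text \<open>
  Write \<open>k = \<lfloor>n/2\<rfloor>\<close> and \<open>a = 2b + e\<close>; the bound on \<open>a/b\<close> says \<open>b \<le> ke\<close>.

  Upper bound: walk around the cycle from \<open>v\<^sub>0\<close>, whose colour set \<open>B\<close> is forced. The colourings of the
  first \<open>i\<close> further vertices obstruct a colour set \<open>X\<close> for the next vertex only through one set \<open>D\<close>,
  of size \<open>b\<close> or \<open>b + e\<close> according to the parity of \<open>i\<close>: every \<open>b\<close>-set \<open>X\<close> with
  \<open>|X \<inter> D| \<le> \<lceil>i/2\<rceil>e\<close> is admissible. At \<open>i = n - 1\<close> the tolerance is \<open>ke \<ge> b\<close>, so the walk can be
  closed with \<open>X = B\<close>.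

  Lower bound: choose the lists so that each obstruction set \<open>D\<close> lies in the next list. Then every
  step of the argument above is tight, and \<open>ke < b\<close> makes the walk impossible to close.
\<close>

text \<open>Disjointness is symmetric, so one of the two arcs of each edge suffices.\<close>

lemma list_coloring_cycle_graph_iff:
  "list_coloring (cycle_graph n) L b c \<longleftrightarrow>
     (\<forall>v<n. c v \<subseteq> L v \<and> card (c v) = b) \<and> (\<forall>v<n. c v \<inter> c (Suc v mod n) = {})"
proof -
  have "(\<forall>(u, v) \<in> parcs (cycle_graph n). c u \<inter> c v = {}) \<longleftrightarrow> (\<forall>v<n. c v \<inter> c (Suc v mod n) = {})"
    by (fastforce simp: cycle_graph_def Int_commute)
  then show ?thesis
    by (auto simp: list_coloring_def cycle_graph_def)
qed

lemma free_choosable_cycle_graphE: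
  fixes L :: "nat \<Rightarrow> nat set"
  assumes "free_choosable (cycle_graph n) a b" and "0 < n"
    and "\<And>v. finite (L v)" and "\<And>v. v \<noteq> 0 \<Longrightarrow> card (L v) = a" and "card (L 0) = b"
  obtains c where "\<And>v. v < n \<Longrightarrow> c v \<subseteq> L v" "\<And>v. v < n \<Longrightarrow> card (c v) = b"
    "\<And>v. v < n \<Longrightarrow> c v \<inter> c (Suc v mod n) = {}"
proof -
  have "0 \<in> pverts (cycle_graph n)" "list_assignment (cycle_graph n) L"
    using assms(2,3) by (auto simp: list_assignment_def cycle_graph_def)
  then obtain c where "list_coloring (cycle_graph n) L b c"
    using assms(1,4,5) unfolding free_choosable_def by blast
  then show ?thesis
    unfolding list_coloring_cycle_graph_iff using that by blast
qed

section \<open>Upper bound: extending a colouring along a path\<close>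

text \<open>All of \<open>S - D\<close> and as much of \<open>S \<inter> D\<close> as
  \<open>t\<close> permits form a pool of at least \<open>b\<close> colours; any \<open>b\<close> of
  them will do.\<close>

lemma ex_subset_card_with_bounded_part:
  assumes "finite S" and "b \<le> card (S - D) + min t (card (S \<inter> D))"
  obtains Y where "Y \<subseteq> S" "card Y = b" "card (Y \<inter> D) \<le> t"
proof -
  obtain T where T: "T \<subseteq> S \<inter> D" "card T = min t (card (S \<inter> D))"
    by (meson min.cobounded2 obtain_subset_with_card_n)
  have "finite T"
    using T(1) assms(1) by (meson finite_Int finite_subset)
  then have "card ((S - D) \<union> T) = card (S - D) + card T"
    using T(1) assms(1) by (intro card_Un_disjoint) auto
  then obtain Y where Y: "Y \<subseteq> (S - D) \<union> T" "card Y = b"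
    using assms(2) T(2) by (metis obtain_subset_with_card_n)
  have "card (Y \<inter> D) \<le> card T"
    using Y(1) \<open>finite T\<close> by (intro card_mono) auto
  then show ?thesis
    using that[of Y] Y T by auto
qed

text \<open>If \<open>D\<close> obstructs after \<open>i\<close> vertices, a part \<open>D'\<close>
  of the next list outside \<open>D\<close> obstructs after one more: the colours of
  \<open>D'\<close> that \<open>X\<close> spares can be used without touching \<open>D\<close>, and
  the tolerance on \<open>D\<close> makes up the rest.\<close>

lemma path_extension_obstruction:
  assumes "finite B" "card B = b" and "\<And>v. finite (L v)"
    and "\<And>v. 1 \<le> v \<Longrightarrow> v \<le> i \<Longrightarrow> card (L v) = 2 * b + e"
  shows "\<exists>D. finite D \<and> card D = (if even i then b else b + e) \<and>
    (\<forall>X. finite X \<longrightarrow> card X = b \<longrightarrow> card (X \<inter> D) \<le> (Suc i div 2) * e \<longrightarrow>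
      (\<exists>c. c 0 = B \<and> (\<forall>v. 1 \<le> v \<and> v \<le> i \<longrightarrow> c v \<subseteq> L v \<and> card (c v) = b) \<and>
           (\<forall>v<i. c v \<inter> c (Suc v) = {}) \<and> c i \<inter> X = {}))"
  using assms(4)
proof (induction i)
  case 0
  have "\<exists>c. c 0 = B \<and> c (0::nat) \<inter> X = {}" if "finite X" "card (X \<inter> B) = 0" for X
    using that by (intro exI[of _ "\<lambda>_. B"]) auto
  then show ?case
    using assms(1,2) by (intro exI[of _ B]) auto
next
  case (Suc i)
  from Suc.IH Suc.prems obtain D where D: "finite D" "card D = (if even i then b else b + e)"
    and ext: "\<And>X. \<lbrakk>finite X; card X = b; card (X \<inter> D) \<le> (Suc i div 2) * e\<rbrakk> \<Longrightarrow>
      \<exists>c. c 0 = B \<and> (\<forall>v. 1 \<le> v \<and> v \<le> i \<longrightarrow> c v \<subseteq> L v \<and> card (c v) = b) \<and>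
          (\<forall>v<i. c v \<inter> c (Suc v) = {}) \<and> c i \<inter> X = {}"
    by force
  let ?L = "L (Suc i)"
  have L: "finite ?L" "card ?L = 2 * b + e"
    using assms(3) Suc.prems by auto
  have "card ?L - card D \<le> card (?L - D)"
    using D(1) by (rule diff_card_le_card_Diff)
  \<comment> \<open>\<open>?L - D\<close> is larger when \<open>D\<close> is not contained in the
    list; trimming it makes the sizes alternate between \<open>b\<close> and
    \<open>b + e\<close>.\<close>
  then obtain D' where D': "D' \<subseteq> ?L - D" "card D' = card ?L - card D"
    by (metis obtain_subset_with_card_n)
  have finD': "finite D'"
    using D'(1) L(1) by (meson finite_Diff finite_subset)
  have cardD': "card D' = (if even (Suc i) then b else b + e)"
    using D' L(2) D(2) by auto
  have "\<exists>c. c 0 = B \<and> (\<forall>v. 1 \<le> v \<and> v \<le> Suc i \<longrightarrow> c v \<subseteq> L v \<and> card (c v) = b) \<and>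
          (\<forall>v<Suc i. c v \<inter> c (Suc v) = {}) \<and> c (Suc i) \<inter> X = {}"
    if X: "finite X" "card X = b" "card (X \<inter> D') \<le> (Suc (Suc i) div 2) * e" for X
  proof -
    let ?S = "?L - X" and ?t = "(Suc i div 2) * e"
    have "card ?L - card X \<le> card ?S"
      using X(1) by (rule diff_card_le_card_Diff)
    moreover have "card ?S = card (?S - D) + card (?S \<inter> D)"
      using L(1) by (metis card_Diff_subset_Int card_Int_Diff finite_Diff add.commute)
    ultimately have total: "b \<le> card (?S - D) + card (?S \<inter> D)"
      using L(2) X(2) by linarith
    have "card D' = card (D' \<inter> X) + card (D' - X)"
      using finD' by (rule card_Int_Diff)
    moreover have "card (D' - X) \<le> card (?S - D)"
      using D'(1) L(1) by (intro card_mono) auto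
    \<comment> \<open>The tolerance grows by \<open>e\<close> exactly when \<open>D'\<close> has
      \<open>e\<close> colours more than \<open>b\<close>, so the two effects cancel.\<close>
    moreover have "(Suc (Suc i) div 2) * e = ?t + (if even i then e else 0)"
      by auto
    ultimately have capped: "b \<le> card (?S - D) + ?t"
      using X(3) cardD' by (auto simp: Int_commute split: if_splits)
    obtain Y where Y: "Y \<subseteq> ?S" "card Y = b" "card (Y \<inter> D) \<le> ?t"
      by (rule ex_subset_card_with_bounded_part[of ?S b D ?t]) (use total capped L(1) in auto)
    have "finite Y"
      using Y(1) L(1) by (meson finite_Diff finite_subset)
    from ext[OF this Y(2,3)] obtain c where
      "c 0 = B" "\<forall>v. 1 \<le> v \<and> v \<le> i \<longrightarrow> c v \<subseteq> L v \<and> card (c v) = b"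
      "\<forall>v<i. c v \<inter> c (Suc v) = {}" "c i \<inter> Y = {}"
      by blast
    with Y show ?thesis
      by (intro exI[of _ "c(Suc i := Y)"]) (auto simp: le_Suc_eq less_Suc_eq)
  qed
  with finD' cardD' show ?case
    by blast
qed

text \<open>Cutting the cycle at \<open>v0\<close> leaves a path whose last colour set must avoid
  \<open>L v0\<close>. The tolerance there is at least \<open>b\<close>, which no set of
  \<open>b\<close> colours can exceed, whatever \<open>D\<close> is.\<close>

lemma free_choosable_cycle_graph:
  assumes "n \<ge> 2" and "b \<le> (n div 2) * e"
  shows "free_choosable (cycle_graph n) (2 * b + e) b"
  unfolding free_choosable_def
proof (intro ballI allI impI)
  fix v0 L
  assume v0: "v0 \<in> pverts (cycle_graph n)" and fin: "list_assignment (cycle_graph n) L"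
    and card: "\<forall>v\<in>pverts (cycle_graph n). v \<noteq> v0 \<longrightarrow> card (L v) = 2 * b + e"
    and card0: "card (L v0) = b"
  have "v0 < n"
    using v0 by (simp add: cycle_graph_def)
  \<comment> \<open>Rotating the indices by \<open>v0\<close> moves the precoloured vertex to
    \<open>0\<close>.\<close>
  define M where "M i = L ((v0 + i) mod n)" for i
  have finM: "finite (M i)" for i
    using fin assms(1) by (simp add: M_def list_assignment_def cycle_graph_def)
  have cardM: "card (M i) = 2 * b + e" if "1 \<le> i" "i \<le> n - 1" for i
  proof -
    have "(v0 + i) mod n \<noteq> v0"
      using that \<open>v0 < n\<close> by (cases "v0 + i < n") (auto simp: le_mod_geq)
    then show ?thesis
      using card assms(1) by (simp add: M_def cycle_graph_def)
  qed
  have M0: "M 0 = L v0" "finite (L v0)"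
    using \<open>v0 < n\<close> finM[of 0] by (auto simp: M_def)
  obtain D where
    ext: "\<forall>X. finite X \<longrightarrow> card X = b \<longrightarrow> card (X \<inter> D) \<le> (Suc (n - 1) div 2) * e \<longrightarrow>
      (\<exists>c. c 0 = L v0 \<and> (\<forall>v. 1 \<le> v \<and> v \<le> n - 1 \<longrightarrow> c v \<subseteq> M v \<and> card (c v) = b) \<and>
          (\<forall>v<n - 1. c v \<inter> c (Suc v) = {}) \<and> c (n - 1) \<inter> X = {})"
    using path_extension_obstruction[where L = M and i = "n - 1", OF M0(2) card0 finM cardM] by auto
  have "card (L v0 \<inter> D) \<le> b"
    using card_mono[OF M0(2), of "L v0 \<inter> D"] card0 by auto
  then obtain c where c: "c 0 = L v0"
    "\<And>v. 1 \<le> v \<Longrightarrow> v \<le> n - 1 \<Longrightarrow> c v \<subseteq> M v \<and> card (c v) = b"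
    "\<And>v. v < n - 1 \<Longrightarrow> c v \<inter> c (Suc v) = {}" "c (n - 1) \<inter> L v0 = {}"
    using ext[rule_format, OF M0(2) card0] assms by auto
  have cM: "c v \<subseteq> M v \<and> card (c v) = b" if "v < n" for v
    using that c(1) c(2)[of v] M0 card0 by (cases "v = 0") auto
  have cdisj: "c v \<inter> c (Suc v mod n) = {}" if "v < n" for v
  proof (cases "v = n - 1")
    case True
    then show ?thesis using c(1,4) that by simp
  next
    case False
    then show ?thesis using c(3)[of v] that by simp
  qed
  \<comment> \<open>The inverse rotation; \<open>n - v0\<close> represents \<open>-v0\<close> modulo
    \<open>n\<close> in the naturals.\<close>
  define f where "f v = (v + (n - v0)) mod n" for v
  have f: "f v < n" "(v0 + f v) mod n = v" "f (Suc v mod n) = Suc (f v) mod n" if "v < n" for v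
  proof -
    show "f v < n" using that by (simp add: f_def)
    have "(v0 + f v) mod n = (v + n) mod n"
      using \<open>v0 < n\<close> by (simp add: f_def mod_simps)
    then show "(v0 + f v) mod n = v"
      using that by simp
    show "f (Suc v mod n) = Suc (f v) mod n"
      by (simp add: f_def mod_simps)
  qed
  have "c (f v) \<subseteq> L v \<and> card (c (f v)) = b" if "v < n" for v
    using cM[OF f(1)[OF that]] f(2)[OF that] by (simp add: M_def)
  then have "list_coloring (cycle_graph n) L b (c \<circ> f)"
    unfolding list_coloring_cycle_graph_iff using cdisj f by simp
  then show "\<exists>c. list_coloring (cycle_graph n) L b c"
    by blast
qed

section \<open>Lower bound: lists that defeat a small surplus\<close>

text \<open>This makes \<open>e = a - 2 * b\<close> a genuine difference. With initial segments as
  lists, vertex \<open>1\<close> loses all colours below \<open>b\<close> to vertex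
  \<open>0\<close>.\<close>

lemma free_choosable_cycle_graph_imp_ge_double:
  assumes "n \<ge> 2" and "free_choosable (cycle_graph n) a b"
  shows "2 * b \<le> a"
proof -
  let ?L = "\<lambda>v. if v = 0 then {..<b} else {..<a}"
  obtain c where c: "\<And>v. v < n \<Longrightarrow> c v \<subseteq> ?L v" "\<And>v. v < n \<Longrightarrow> card (c v) = b"
    "\<And>v. v < n \<Longrightarrow> c v \<inter> c (Suc v mod n) = {}"
    by (rule free_choosable_cycle_graphE[OF assms(2), of ?L]) (use assms(1) in auto)
  have "c 0 = {..<b}"
    using c(1,2)[of 0] assms(1) by (intro card_subset_eq) auto
  moreover have "c 1 \<subseteq> {..<a}" "card (c 1) = b" "c 0 \<inter> c 1 = {}"
    using c(1,2)[of 1] c(3)[of 0] assms(1) by auto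
  ultimately have "c 1 \<subseteq> {..<a} - {..<b}"
    by blast
  also have "\<dots> = {b..<a}"
    by auto
  finally have "b \<le> a - b"
    using card_mono[of "{b..<a}" "c 1"] \<open>card (c 1) = b\<close> by simp
  then show ?thesis by linarith
qed

text \<open>Vertex \<open>0\<close> takes \<open>{..<b}\<close>, which forces vertex
  \<open>1\<close> into \<open>A\<close>. From there the colour sets are pushed alternately into
  \<open>C\<close> and \<open>A\<close>: \<open>C\<close> has no spare colours and \<open>A\<close>
  has \<open>e\<close>, so at most \<open>e\<close> more colours land on the wrong side every two
  steps. Vertex \<open>n - 1\<close>, confined to \<open>F\<close>, then competes with vertex
  \<open>n - 2\<close> for \<open>b + e\<close> colours.\<close>

lemma free_choosable_cycle_graph_imp_le:
  assumes "n \<ge> 3" and "free_choosable (cycle_graph n) (2 * b + e) b"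
  shows "b \<le> (n div 2) * e"
proof -
  define A where "A = {b..<2 * b + e}"
  define C where "C = {2 * b + e..<3 * b + e}"
  \<comment> \<open>\<open>F\<close> plays the role of the obstruction set at the last vertex; for even \<open>n\<close> that set is \<open>C\<close>,
    which is \<open>e\<close> colours too small and is padded.\<close>
  define F where "F = (if even n then {2 * b + e..<3 * b + 2 * e} else A)"
  define L where "L v = (if v = 0 then {..<b} else if v = n - 1 then {..<b} \<union> F
    else if v = 1 then {..<b} \<union> A else A \<union> C)" for v
  have card_un: "card (S \<union> T) = card S + card T"
    if "finite S" "finite T" "S \<inter> T = {}" for S T :: "nat set"
    using that by (rule card_Un_disjoint)
  have cardF: "card F = b + e" "finite F" "{..<b} \<inter> F = {}"
    by (auto simp: F_def A_def)
  have AC: "finite A" "finite C" "card A = b + e" "card C = b" "A \<inter> C = {}" "{..<b} \<inter> A = {}"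
    by (auto simp: A_def C_def)
  have finL: "finite (L v)" for v
    using AC cardF by (simp add: L_def)
  have cardL: "card (L v) = 2 * b + e" if "v \<noteq> 0" for v
    using AC cardF that by (simp add: L_def card_un)
  have "card (L 0) = b"
    by (simp add: L_def)
  then obtain c where c: "\<And>v. v < n \<Longrightarrow> c v \<subseteq> L v" "\<And>v. v < n \<Longrightarrow> card (c v) = b"
    "\<And>v. v < n \<Longrightarrow> c v \<inter> c (Suc v mod n) = {}"
    using free_choosable_cycle_graphE[where L = L, OF assms(2) _ finL cardL] assms(1)
    by (metis gr_zeroI not_numeral_le_zero)
  have c0: "c 0 = {..<b}"
    using c(1,2)[of 0] assms(1) by (intro card_subset_eq) (auto simp: L_def)
  have disj: "card (c v \<inter> S) + card (c (Suc v) \<inter> S) \<le> card S"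
    if "Suc v < n" "finite S" for v S
  proof -
    have "card ((c v \<inter> S) \<union> (c (Suc v) \<inter> S)) = card (c v \<inter> S) + card (c (Suc v) \<inter> S)"
      using c(3)[of v] that by (intro card_un) auto
    then show ?thesis
      using card_mono[OF that(2), of "(c v \<inter> S) \<union> (c (Suc v) \<inter> S)"] by auto
  qed
  have c1: "c 1 \<subseteq> A"
  proof -
    have "c 1 \<subseteq> {..<b} \<union> A"
      using c(1)[of 1] assms(1) by (auto simp: L_def F_def split: if_splits)
    moreover have "c 0 \<inter> c 1 = {}"
      using c(3)[of 0] assms(1) by simp
    ultimately show ?thesis
      using c0 by blast
  qed
  \<comment> \<open>Here \<open>(i div 2) * e\<close> bounds the colours of \<open>c i\<close> on
    the wrong side.\<close>
  have inv: "b \<le> card (c i \<inter> (if even i then C else A)) + (i div 2) * e"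
    if "1 \<le> i" "i \<le> n - 2" for i
    using that
  proof (induction i rule: dec_induct)
    case base
    show ?case
      using c1 c(2)[of 1] assms(1) by (simp add: Int_absorb2)
  next
    case (step i)
    let ?P = "if even i then C else A" and ?Q = "if even i then A else C"
    have "Suc i \<noteq> n - 1" "Suc i \<noteq> 1" "Suc i < n"
      using step assms(1) by linarith+
    then have "c (Suc i) \<subseteq> A \<union> C"
      using c(1)[of "Suc i"] by (simp add: L_def)
    then have "c (Suc i) = (c (Suc i) \<inter> ?P) \<union> (c (Suc i) \<inter> ?Q)"
      by auto
    moreover have "card \<dots> = card (c (Suc i) \<inter> ?P) + card (c (Suc i) \<inter> ?Q)"
      using AC by (intro card_un) auto
    moreover have "card (c (Suc i)) = b"
      using c(2) step assms(1) by simp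
    ultimately have "b = card (c (Suc i) \<inter> ?P) + card (c (Suc i) \<inter> ?Q)"
      by metis
    moreover have "card (c i \<inter> ?P) + card (c (Suc i) \<inter> ?P) \<le> card ?P"
      using step assms(1) AC by (intro disj) auto
    moreover have "b \<le> card (c i \<inter> ?P) + (i div 2) * e"
      using step by simp
    \<comment> \<open>Only a step out of odd \<open>i\<close>, where \<open>?P\<close> is
      \<open>A\<close>, adds \<open>e\<close> to the deficit.\<close>
    moreover have "card ?P = b + (if even i then 0 else e)"
      using AC by simp
    moreover have "(Suc i div 2) * e = (i div 2) * e + (if even i then 0 else e)"
      by auto
    ultimately show ?case
      by (auto split: if_splits)
  qed
  let ?P = "if even (n - 2) then C else A"
  have "c (n - 1) \<subseteq> {..<b} \<union> F"
    using c(1)[of "n - 1"] assms(1) by (simp add: L_def)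
  moreover have "c (n - 1) \<inter> c 0 = {}"
    using c(3)[of "n - 1"] assms(1) by simp
  ultimately have "c (n - 1) \<inter> F = c (n - 1)"
    using c0 by blast
  moreover have "card (c (n - 2) \<inter> F) + card (c (Suc (n - 2)) \<inter> F) \<le> card F"
    using assms(1) cardF by (intro disj) auto
  moreover have "Suc (n - 2) = n - 1"
    using assms(1) by simp
  \<comment> \<open>\<open>F\<close> contains \<open>?P\<close>, so the colours counted by
    \<open>inv\<close> use up room in \<open>F\<close>; the surplus \<open>e\<close> of
    \<open>F\<close> over \<open>b\<close> supplies the last of the \<open>n div 2\<close> multiples
    of \<open>e\<close>.\<close>
  moreover have "card (c (n - 2) \<inter> ?P) \<le> card (c (n - 2) \<inter> F)"
    using cardF assms(1) by (intro card_mono) (auto simp: F_def C_def)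
  moreover have "b \<le> card (c (n - 2) \<inter> ?P) + ((n - 2) div 2) * e"
    using inv[of "n - 2"] assms(1) by simp
  moreover have "n div 2 = Suc ((n - 2) div 2)"
    using assms(1) by linarith
  ultimately show ?thesis
    using cardF(1) c(2)[of "n - 1"] assms(1) by simp
qed

theorem theorem3:
  fixes n :: nat
  assumes "n \<ge> 3"
  shows "(\<forall>a b :: nat. 0 < a \<longrightarrow> 0 < b \<longrightarrow>
            real a / real b \<ge> 2 + inverse (real_of_int \<lfloor>real n / 2\<rfloor>) \<longrightarrow>
            free_choosable (cycle_graph n) a b)
       \<and> fchr (cycle_graph n) = 2 + inverse (real_of_int \<lfloor>real n / 2\<rfloor>)"
proof -
  define k where "k = n div 2"
  have "k > 0"
    using assms by (simp add: k_def div_greater_zero_iff)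
  have k: "real_of_int \<lfloor>real n / 2\<rfloor> = real k"
    using floor_divide_of_nat_eq[of n 2, where ?'a = real] by (simp add: k_def)
  have ratio: "2 + inverse (real k) \<le> real (2 * b + e) / real b \<longleftrightarrow> b \<le> k * e" if "b > 0" for b e
  proof -
    have "2 + inverse (real k) \<le> real (2 * b + e) / real b \<longleftrightarrow> real b \<le> real (k * e)"
      using that \<open>k > 0\<close> by (simp add: field_simps)
    then show ?thesis
      by (simp only: of_nat_le_iff)
  qed
  have upper: "free_choosable (cycle_graph n) a b"
    if "b > 0" "2 + inverse (real k) \<le> real a / real b" for a b
  proof -
    have "2 \<le> real a / real b"
      using that(2) by (smt (verit) inverse_nonnegative_iff_nonnegative of_nat_0_le_iff)
    then have "real (2 * b) \<le> real a"
      using that(1) by (simp add: field_simps)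
    then obtain e where "a = 2 * b + e"
      by (metis of_nat_le_iff le_iff_add)
    then show ?thesis
      using free_choosable_cycle_graph[of n b e] ratio that assms by (simp add: k_def)
  qed
  have lower: "2 + inverse (real k) \<le> real a / real b"
    if b: "b > 0" and free: "free_choosable (cycle_graph n) a b" for a b
  proof -
    obtain e where "a = 2 * b + e"
      using free_choosable_cycle_graph_imp_ge_double[OF _ free] assms le_iff_add by auto
    then show ?thesis
      using free_choosable_cycle_graph_imp_le[OF assms] free ratio[OF b] by (simp add: k_def)
  qed
  \<comment> \<open>The choice \<open>b = k\<close>, \<open>e = 1\<close> meets the bound exactly,
    so the infimum is a minimum.\<close>
  have attained: "2 + inverse (real k) = real (2 * k + 1) / real k"
    using \<open>k > 0\<close> by (simp add: field_simps)
  have "fchr (cycle_graph n) = 2 + inverse (real k)"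
    unfolding fchr_def
  proof (rule cInf_eq_minimum)
    have "free_choosable (cycle_graph n) (2 * k + 1) k"
      using upper \<open>k > 0\<close> attained by simp
    then show "2 + inverse (real k) \<in>
        {real a / real b |a b. 0 < a \<and> 0 < b \<and> free_choosable (cycle_graph n) a b}"
      using attained \<open>k > 0\<close> by (intro CollectI exI[of _ "2 * k + 1"] exI[of _ k]) simp
  qed (use lower in auto)
  then show ?thesis
    using upper by (simp add: k)
qed

end
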